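(* Let $0<\alpha\le\pi/2$ and put $$A_\alpha:=\sin\alpha\begin{pmatrix}0&1\\0&0\end{pmatrix}.$$ Then $\|A_\alpha-i\cot\alpha\,I\|=\csc\alpha$ and $\|A_\alpha+i\cot\alpha\,I\|=\csc\alpha$ (so both disks $D_\alpha^{\pm}$ are spectral sets for $A_\alpha$, with equality in both disk constraints), and $$C(\alpha)\ge\frac{\pi\sin\alpha}{2\alpha}.$$ More precisely, there is a sequence of polynomials $p_n\in\mathbb C[z]$ with $\max_{\mathcal L_\alpha}|p_n|\le 1+o(1)$ and $$\|p_n(A_\alpha)\|\longrightarrow\frac{\pi\sin\alpha}{2\alpha}.$$
   Context: $D_\alpha^{\pm}=\{z\in\mathbb C:|z\mp i\cot\alpha|\le\csc\alpha\}$ and $\mathcal L_\alpha=D_\alpha^+\cap D_\alpha^-$. The constant $C(\alpha)$ is $$C(\alpha)=\sup_{\mathcal H,A}\ \sup_{p\in\mathbb C[z],\,p\ne0}\frac{\|p(A)\|}{\max_{z\in\mathcal L_\alpha}|p(z)|},$$ where the first supremum is over all complex Hilbert spaces $\mathcal H$ and all bounded operators $A$ on $\mathcal H$ with $\|A-i\cot\alpha\, I\|\le\csc\alpha$ and $\|A+i\cot\alpha\, I\|\le\csc\alpha$. *)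

theory Defs
  imports
    "HOL-Analysis.Analysis"
    "HOL-Computational_Algebra.Polynomial"
    "HOL-Algebra.Module"
begin

text \<open>
  The supremum defining \<open>C(\<alpha>)\<close> ranges over all Hilbert spaces, which a quantification over
  elements of a type class cannot express. Hilbert spaces are therefore modules on a carrier set,
  with an inner product that is linear in its first argument. The fields \<open>mult\<close> and \<open>one\<close>
  inherited from the ring record are unused.
\<close>

definition complex_ring :: "complex ring" where
  "complex_ring = \<lparr>carrier = UNIV, monoid.mult = (*), one = 1, zero = 0, add = (+)\<rparr>"

record 'h hilbert = "(complex, 'h) module" +
  ip :: "'h \<Rightarrow> 'h \<Rightarrow> complex"

definition hnorm :: "('h, 'm) hilbert_scheme \<Rightarrow> 'h \<Rightarrow> real" where
  "hnorm H x = sqrt (Re (ip H x x))"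

locale complex_hilbert = Module.module complex_ring H
  for H :: "('h, 'm) hilbert_scheme" (structure) +
  assumes ip_add_left:
      "\<lbrakk>x \<in> carrier H; y \<in> carrier H; z \<in> carrier H\<rbrakk> \<Longrightarrow> ip H (x \<oplus> y) z = ip H x z + ip H y z"
    and ip_smult_left:
      "\<lbrakk>x \<in> carrier H; y \<in> carrier H\<rbrakk> \<Longrightarrow> ip H (c \<odot> x) y = c * ip H x y"
    and ip_cnj: "\<lbrakk>x \<in> carrier H; y \<in> carrier H\<rbrakk> \<Longrightarrow> ip H y x = cnj (ip H x y)"
    and ip_nonneg: "x \<in> carrier H \<Longrightarrow> 0 \<le> Re (ip H x x)"
    and ip_definite: "\<lbrakk>x \<in> carrier H; ip H x x = 0\<rbrakk> \<Longrightarrow> x = \<zero>"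
    and complete: "Metric_space.mcomplete (carrier H) (\<lambda>x y. hnorm H (x \<ominus> y))"

text \<open>Operators are functions on the underlying type of which only the restriction to the carrier
  matters.\<close>

definition bounded_operator :: "('h, 'm) hilbert_scheme \<Rightarrow> ('h \<Rightarrow> 'h) \<Rightarrow> bool" where
  "bounded_operator H A \<longleftrightarrow>
     A \<in> carrier H \<rightarrow> carrier H \<and>
     (\<forall>x\<in>carrier H. \<forall>y\<in>carrier H. A (x \<oplus>\<^bsub>H\<^esub> y) = A x \<oplus>\<^bsub>H\<^esub> A y) \<and>
     (\<forall>c. \<forall>x\<in>carrier H. A (c \<odot>\<^bsub>H\<^esub> x) = c \<odot>\<^bsub>H\<^esub> A x) \<and>
     (\<exists>K. \<forall>x\<in>carrier H. hnorm H (A x) \<le> K * hnorm H x)"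

definition op_norm :: "('h, 'm) hilbert_scheme \<Rightarrow> ('h \<Rightarrow> 'h) \<Rightarrow> real" where
  "op_norm H A = (SUP x\<in>{x \<in> carrier H. hnorm H x \<le> 1}. hnorm H (A x))"

text \<open>\<open>op_shift H A c\<close> is \<open>A - c I\<close>, and \<open>op_poly H p A\<close> is \<open>p(A)\<close>.\<close>

definition op_shift :: "('h, 'm) hilbert_scheme \<Rightarrow> ('h \<Rightarrow> 'h) \<Rightarrow> complex \<Rightarrow> 'h \<Rightarrow> 'h" where
  "op_shift H A c = (\<lambda>x. A x \<ominus>\<^bsub>H\<^esub> c \<odot>\<^bsub>H\<^esub> x)"

definition op_poly :: "('h, 'm) hilbert_scheme \<Rightarrow> complex poly \<Rightarrow> ('h \<Rightarrow> 'h) \<Rightarrow> 'h \<Rightarrow> 'h" where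
  "op_poly H p A = (\<lambda>x. \<Oplus>\<^bsub>H\<^esub>k\<in>{..degree p}. coeff p k \<odot>\<^bsub>H\<^esub> (A ^^ k) x)"

definition disk_plus :: "real \<Rightarrow> complex set" where
  "disk_plus \<alpha> = {z. cmod (z - \<i> * of_real (cot \<alpha>)) \<le> 1 / sin \<alpha>}"

definition disk_minus :: "real \<Rightarrow> complex set" where
  "disk_minus \<alpha> = {z. cmod (z + \<i> * of_real (cot \<alpha>)) \<le> 1 / sin \<alpha>}"

definition lens :: "real \<Rightarrow> complex set" where
  "lens \<alpha> = disk_plus \<alpha> \<inter> disk_minus \<alpha>"

text \<open>On a nonempty compact set, and for continuous \<open>f\<close>, this supremum is a maximum.\<close>

definition max_mod :: "complex set \<Rightarrow> (complex \<Rightarrow> complex) \<Rightarrow> real" where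
  "max_mod S f = (SUP z\<in>S. cmod (f z))"

text \<open>
  HOL has no supremum over the proper class of all Hilbert spaces, so the outer supremum is
  relative to a universe: it ranges over the Hilbert spaces whose carrier is a subset of the type
  \<open>'u \<Rightarrow> complex\<close>. Every Hilbert space is isometric to a closed subspace of some \<open>\<ell>\<^sup>2('u)\<close>, a subset
  of that type, so letting \<open>'u\<close> vary reaches all of them. Every choice of \<open>'u\<close> reaches all
  separable ones, and restricting an operator to the closed cyclic subspaces of its vectors shows that the value does
  not depend on \<open>'u\<close>. The supremum is taken in \<open>ereal\<close>, so that no finiteness is presupposed.
\<close>

definition admissible ::
    "real \<Rightarrow> ('u \<Rightarrow> complex) hilbert \<Rightarrow> (('u \<Rightarrow> complex) \<Rightarrow> ('u \<Rightarrow> complex)) \<Rightarrow> bool" where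
  "admissible \<alpha> H A \<longleftrightarrow>
     complex_hilbert H \<and> bounded_operator H A \<and>
     op_norm H (op_shift H A (\<i> * of_real (cot \<alpha>))) \<le> 1 / sin \<alpha> \<and>
     op_norm H (op_shift H A (- \<i> * of_real (cot \<alpha>))) \<le> 1 / sin \<alpha>"

definition lens_const :: "'u itself \<Rightarrow> real \<Rightarrow> ereal" where
  "lens_const _ \<alpha> =
     (SUP (H, A) \<in> {(H :: ('u \<Rightarrow> complex) hilbert, A). admissible \<alpha> H A}.
        SUP p \<in> {p. p \<noteq> 0}. ereal (op_norm H (op_poly H p A) / max_mod (lens \<alpha>) (poly p)))"

text \<open>The norm on \<open>complex ^ 'n\<close> is the Euclidean one, so this is the operator norm on \<open>\<complex>\<^sup>n\<close>.\<close>

definition mat_norm :: "complex ^ 'n ^ 'n \<Rightarrow> real" where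
  "mat_norm M = onorm ((*v) M)"

text \<open>The class operations \<open>(*)\<close> and \<open>(^)\<close> on \<open>complex ^ 'n ^ 'n\<close> act entrywise, hence the
  explicit powers with respect to \<open>(**)\<close>; \<open>mat c\<close> is the scalar matrix \<open>c I\<close>.\<close>

definition mat_poly :: "complex poly \<Rightarrow> complex ^ 'n ^ 'n \<Rightarrow> complex ^ 'n ^ 'n" where
  "mat_poly p M = (\<Sum>k\<le>degree p. mat (coeff p k) ** (((**) M) ^^ k) (mat 1))"

text \<open>A compact set is spectral for \<open>M\<close> if it contains the spectrum of \<open>M\<close> and the von Neumann
  inequality holds for all rational functions \<open>p / q\<close> with poles off the set. The inverse of
  \<open>q(M)\<close> exists because \<open>q\<close> does not vanish on the spectrum.\<close>

definition spectral_set :: "complex set \<Rightarrow> complex ^ 'n ^ 'n \<Rightarrow> bool" where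
  "spectral_set X M \<longleftrightarrow>
     compact X \<and> {z. \<not> invertible (M - mat z)} \<subseteq> X \<and>
     (\<forall>p q. (\<forall>z\<in>X. poly q z \<noteq> 0) \<longrightarrow>
        mat_norm (mat_poly p M ** matrix_inv (mat_poly q M)) \<le> max_mod X (\<lambda>z. poly p z / poly q z))"

definition A_mat :: "real \<Rightarrow> complex ^ 2 ^ 2" where
  "A_mat \<alpha> = sin \<alpha> *\<^sub>R vector [vector [0, 1], vector [0, 0]]"

end

theory Submission
  imports Defs "HOL-Complex_Analysis.Complex_Analysis"
begin

text \<open>
  Since \<open>A_mat \<alpha>\<close> squares to zero, a function \<open>f\<close> of it is the matrix with diagonal \<open>f 0\<close> and corner
  \<open>sin \<alpha> * f' 0\<close>. Everything is thus a question about the value and the derivative of functions at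
  the origin.

  A matrix with diagonal \<open>a\<close> and corner \<open>b\<close> has norm at most \<open>M\<close> if \<open>M \<bar>b\<bar> \<le> M\<^sup>2 - \<bar>a\<bar>\<^sup>2\<close>, and norm
  equal to \<open>M\<close> in the case of equality (\<open>mat_norm_toeplitz2_le\<close>, \<open>mat_norm_toeplitz2_eq\<close>). With
  \<open>\<bar>a\<bar> = cot \<alpha>\<close>, \<open>b = sin \<alpha>\<close> and \<open>M = csc \<alpha>\<close> equality holds, which gives the two norms in the
  theorem. For a function \<open>f\<close> on a disc with a Moebius parametrisation \<open>\<psi>\<close> that fixes the origin and
  has \<open>\<psi>' 0 = sin \<alpha>\<close>, the condition is the Schwarz-Pick inequality for \<open>f \<circ> \<psi>\<close>. Both discs have such
  a parametrisation, and so they are spectral sets (\<open>spectral_set_disk\<close>).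

  The lower bound comes from the Riemann map of the lens. The map \<open>(1 + z) / (1 - z)\<close> takes the lens
  to the sector \<open>\<bar>arg w\<bar> \<le> \<alpha>\<close>, the power \<open>\<beta> = \<pi> / (2 \<alpha>)\<close> takes the sector to the right half-plane,
  and the Cayley transform takes that to the unit disc. The composite is bounded by 1, vanishes at
  the origin and has derivative \<open>\<beta>\<close> there. So it takes \<open>A_mat \<alpha>\<close> to a matrix of norm
  \<open>\<beta> sin \<alpha> = \<pi> sin \<alpha> / (2 \<alpha>)\<close>. For \<open>\<alpha> < \<pi> / 2\<close> this map is not a polynomial, but composed with a scaling by
  \<open>r < 1\<close> it is a uniform limit of polynomials on the lens (\<open>poly_approximable_lens_map\<close>), and letting
  \<open>r\<close> tend to 1 yields the required sequence (\<open>exists_lens_polynomial_sequence\<close>).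

  For the bound on \<open>lens_const\<close>, the space \<open>complex ^ 2\<close> with \<open>A_mat \<alpha>\<close> acting on it is transported
  along an injection into \<open>'u \<Rightarrow> complex\<close>, where it becomes one of the competitors
  (\<open>lens_const_ge_matrix_ratio\<close>).
\<close>

no_notation fps_nth (infixl "$" 75)

section \<open>Upper triangular Toeplitz matrices of order two\<close>

definition toeplitz2 :: "complex \<Rightarrow> complex \<Rightarrow> complex ^ 2 ^ 2" where
  "toeplitz2 a b = vector [vector [a, b], vector [0, a]]"

lemma toeplitz2_nth [simp]:
  "toeplitz2 a b $ 1 $ 1 = a" "toeplitz2 a b $ 1 $ 2 = b"
  "toeplitz2 a b $ 2 $ 1 = 0" "toeplitz2 a b $ 2 $ 2 = a"
  by (simp_all add: toeplitz2_def)

lemma toeplitz2_add: "toeplitz2 a b + toeplitz2 c d = toeplitz2 (a + c) (b + d)"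
  by (simp add: vec_eq_iff forall_2)

lemma toeplitz2_diff: "toeplitz2 a b - toeplitz2 c d = toeplitz2 (a - c) (b - d)"
  by (simp add: vec_eq_iff forall_2)

lemma toeplitz2_mult:
  "toeplitz2 a b ** toeplitz2 c d = toeplitz2 (a * c) (a * d + b * c)"
  by (simp add: vec_eq_iff forall_2 matrix_matrix_mult_def sum_2)

lemma mat_eq_toeplitz2: "mat c = toeplitz2 c 0"
  by (simp add: vec_eq_iff forall_2 mat_def)

lemma A_mat_eq_toeplitz2: "A_mat \<alpha> = toeplitz2 0 (of_real (sin \<alpha>))"
  by (simp add: vec_eq_iff forall_2 A_mat_def of_real_def)

lemma toeplitz2_vector_mult:
  "toeplitz2 a b *v x = vector [a * x $ 1 + b * x $ 2, a * x $ 2]"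
  by (simp add: vec_eq_iff forall_2 matrix_vector_mult_def sum_2)

lemma norm_complex2: "norm (x :: complex ^ 2) = sqrt ((cmod (x $ 1))\<^sup>2 + (cmod (x $ 2))\<^sup>2)"
  by (simp add: norm_vec_def L2_set_def sum_2)

lemma norm_vec_complex_sqr: "(norm (x :: complex ^ 'n))\<^sup>2 = (\<Sum>i\<in>UNIV. (cmod (x $ i))\<^sup>2)"
  by (simp add: norm_vec_def L2_set_def sum_nonneg)

text \<open>
  This is the condition that also appears in the Schwarz-Pick inequality. It suffices because, with \<open>B\<close> the extremal value of \<open>\<bar>b\<bar>\<close>, and \<open>s\<close>, \<open>t\<close> the moduli of the two
  coordinates of \<open>x\<close>, the defect \<open>M\<^sup>2 (s\<^sup>2 + t\<^sup>2) - (\<bar>a\<bar> s + B t)\<^sup>2 - (\<bar>a\<bar> t)\<^sup>2\<close> is \<open>B / M\<close> times the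
  square of \<open>M s - \<bar>a\<bar> t\<close>.
\<close>

lemma norm_toeplitz2_vector_le:
  assumes "0 < M" and "M * cmod b \<le> M\<^sup>2 - (cmod a)\<^sup>2"
  shows "norm (toeplitz2 a b *v x) \<le> M * norm x"
proof -
  define s t where "s = cmod (x $ 1)" and "t = cmod (x $ 2)"
  define A B where "A = cmod a" and "B = (M\<^sup>2 - A\<^sup>2) / M"
  have bB: "cmod b \<le> B" and MB: "M * B = M\<^sup>2 - A\<^sup>2"
    using assms by (simp_all add: B_def A_def pos_le_divide_eq mult.commute)
  have "0 \<le> B"
    using norm_ge_zero bB by (rule order_trans)
  note B = bB MB this
  have nonneg: "0 \<le> s" "0 \<le> t" "0 \<le> A" by (simp_all add: s_def t_def A_def)
  have "cmod (a * x $ 1 + b * x $ 2) \<le> A * s + B * t"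
    using norm_triangle_ineq[of "a * x $ 1" "b * x $ 2"] mult_right_mono[OF B(1) nonneg(2)]
    by (simp add: norm_mult s_def t_def A_def)
  then have "(cmod (a * x $ 1 + b * x $ 2))\<^sup>2 \<le> (A * s + B * t)\<^sup>2"
    by (simp add: power_mono)
  then have "(norm (toeplitz2 a b *v x))\<^sup>2 \<le> (A * s + B * t)\<^sup>2 + (A * t)\<^sup>2"
    by (simp add: norm_complex2 toeplitz2_vector_mult norm_mult A_def t_def)
  also have "\<dots> \<le> M\<^sup>2 * (s\<^sup>2 + t\<^sup>2)"
  proof -
    have A2: "A\<^sup>2 = M\<^sup>2 - M * B" using B by simp
    have "M * (M\<^sup>2 * (s\<^sup>2 + t\<^sup>2) - (A * s + B * t)\<^sup>2 - (A * t)\<^sup>2)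
        = M * (s\<^sup>2 + t\<^sup>2) * M\<^sup>2 - M * (s\<^sup>2 + t\<^sup>2) * A\<^sup>2 - 2 * A * s * t * (M * B) - B * t\<^sup>2 * (M * B)"
      by (simp add: power2_eq_square algebra_simps)
    also have "\<dots> = B * (M * s - A * t)\<^sup>2"
      unfolding A2 power2_diff power_mult_distrib by (simp add: algebra_simps power2_eq_square)
    finally have "0 \<le> M * (M\<^sup>2 * (s\<^sup>2 + t\<^sup>2) - (A * s + B * t)\<^sup>2 - (A * t)\<^sup>2)"
      using B(3) by simp
    with assms(1) show ?thesis
      by (simp add: zero_le_mult_iff)
  qed
  also have "\<dots> = (M * norm x)\<^sup>2"
    by (simp add: norm_complex2 power_mult_distrib s_def t_def)
  finally show ?thesis
    by (rule power2_le_imp_le) (use assms in simp)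
qed

lemma mat_norm_toeplitz2_le:
  assumes "0 < M" and "M * cmod b \<le> M\<^sup>2 - (cmod a)\<^sup>2"
  shows "mat_norm (toeplitz2 a b) \<le> M"
  unfolding mat_norm_def by (rule onorm_le) (rule norm_toeplitz2_vector_le[OF assms])

lemma mat_norm_toeplitz2_eq:
  assumes "0 < M" and "0 \<le> b" and eq: "M * b = M\<^sup>2 - (cmod a)\<^sup>2"
  shows "mat_norm (toeplitz2 a (of_real b)) = M"
proof (rule antisym)
  show "mat_norm (toeplitz2 a (of_real b)) \<le> M"
    using assms by (intro mat_norm_toeplitz2_le) auto
  \<comment> \<open>The square in the upper bound vanishes when the moduli of the coordinates are in the ratio of
    \<open>\<bar>a\<bar>\<close> to \<open>M\<close>; the conjugate gives the two terms of the first coordinate of the image the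
    same argument.\<close>
  define v :: "complex ^ 2" where "v = vector [cnj a, of_real M]"
  have "a * cnj a + of_real b * of_real M = of_real (M\<^sup>2)"
    using arg_cong[OF eq, of complex_of_real]
    by (simp add: complex_norm_square[symmetric] algebra_simps)
  then have "toeplitz2 a (of_real b) *v v = vector [of_real M * of_real M, of_real M * a]"
    by (simp add: v_def toeplitz2_vector_mult power2_eq_square mult.commute)
  then have "norm (toeplitz2 a (of_real b) *v v) = sqrt (M\<^sup>2 * ((cmod a)\<^sup>2 + M\<^sup>2))"
    by (simp add: norm_complex2 norm_mult power_mult_distrib algebra_simps power2_eq_square)
  also have "\<dots> = M * norm v"
    using assms(1) by (simp add: norm_complex2 v_def real_sqrt_mult)
  finally have nv: "norm (toeplitz2 a (of_real b) *v v) = M * norm v" .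
  have "norm (toeplitz2 a (of_real b) *v v) \<le> mat_norm (toeplitz2 a (of_real b)) * norm v"
    unfolding mat_norm_def by (intro onorm matrix_vector_mul_bounded_linear)
  moreover have "v \<noteq> 0"
    using assms(1) by (auto simp: v_def vec_eq_iff forall_2)
  ultimately show "M \<le> mat_norm (toeplitz2 a (of_real b))"
    by (simp add: nv)
qed

lemma mat_norm_toeplitz2_0: "mat_norm (toeplitz2 0 b) = cmod b"
proof (rule antisym)
  show "mat_norm (toeplitz2 0 b) \<le> cmod b"
    unfolding mat_norm_def
  proof (rule onorm_le)
    fix x :: "complex ^ 2"
    have "cmod (x $ 2) \<le> norm x" by (rule Finite_Cartesian_Product.norm_nth_le)
    then show "norm (toeplitz2 0 b *v x) \<le> cmod b * norm x"
      by (simp add: norm_complex2[of "vector _"] toeplitz2_vector_mult norm_mult mult_left_mono)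
  qed
  have "norm (toeplitz2 0 b *v vector [0, 1]) \<le> mat_norm (toeplitz2 0 b) * norm (vector [0, 1] :: complex ^ 2)"
    unfolding mat_norm_def by (intro onorm matrix_vector_mul_bounded_linear)
  then show "cmod b \<le> mat_norm (toeplitz2 0 b)"
    by (simp add: norm_complex2 toeplitz2_vector_mult)
qed

lemma sum_atMost_eq_first_two:
  fixes g :: "nat \<Rightarrow> 'a :: comm_monoid_add"
  assumes "\<And>k. 2 \<le> k \<Longrightarrow> g k = 0" and "n = 0 \<Longrightarrow> g 1 = 0"
  shows "(\<Sum>k\<le>n. g k) = g 0 + g 1"
proof (cases "n = 0")
  case False
  have "(\<Sum>k\<le>n. g k) = (\<Sum>k\<in>{0, 1}. g k)"
  proof (rule sum.mono_neutral_right)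
    show "\<forall>k\<in>{..n} - {0, 1}. g k = 0"
    proof
      fix k assume "k \<in> {..n} - {0, 1}"
      then have "2 \<le> k" by auto
      then show "g k = 0" by (rule assms(1))
    qed
  qed (use False in auto)
  then show ?thesis by simp
qed (use assms in simp)

text \<open>
  The matrix squares to zero, so only the two lowest coefficients of \<open>p\<close> survive.
\<close>

lemma mat_poly_nilpotent_toeplitz2:
  "mat_poly p (toeplitz2 0 b) = toeplitz2 (poly p 0) (b * poly (pderiv p) 0)"
proof -
  let ?N = "toeplitz2 0 b"
  have pow: "((**) ?N ^^ k) (mat 1) = 0" if k: "2 \<le> k" for k
  proof -
    obtain j where "k = 2 + j"
      using le_Suc_ex[OF k] by blast
    moreover have "?N ** ?N = 0"
      by (simp add: toeplitz2_mult) (simp add: vec_eq_iff forall_2)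
    then have "?N ** (?N ** X) = 0" for X
      by (simp add: matrix_mul_assoc)
    ultimately show ?thesis by simp
  qed
  have "mat_poly p ?N = mat (coeff p 0) ** ((**) ?N ^^ 0) (mat 1) + mat (coeff p 1) ** ((**) ?N ^^ 1) (mat 1)"
    unfolding mat_poly_def
    by (rule sum_atMost_eq_first_two) (simp_all add: pow coeff_eq_0)
  then show ?thesis
    by (simp add: mat_eq_toeplitz2 toeplitz2_mult toeplitz2_add poly_0_coeff_0 coeff_pderiv mult.commute)
qed

section \<open>The Schwarz-Pick inequality and spectral discs\<close>

lemma Moebius_function_has_field_derivative:
  assumes "1 - cnj w * z \<noteq> 0"
  shows "(Moebius_function 0 w has_field_derivative (1 - cnj w * w) / (1 - cnj w * z)\<^sup>2) (at z)"
proof -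
  have "((\<lambda>z. (z - w) / (1 - cnj w * z)) has_field_derivative
      (1 * (1 - cnj w * z) - (z - w) * (- cnj w)) / ((1 - cnj w * z) * (1 - cnj w * z))) (at z)"
    using assms by (intro DERIV_divide) (auto intro!: derivative_eq_intros)
  then show ?thesis
    by (simp add: Moebius_function_simple[abs_def] power2_eq_square algebra_simps)
qed

text \<open>
  The Moebius function that takes \<open>f 0 / M\<close> to 0, composed with \<open>f / M\<close>, is a self-map of the
  disc fixing 0; its derivative there is bounded by 1 by the Schwarz lemma.
\<close>

lemma Schwarz_Pick_at_0:
  assumes hol: "f holomorphic_on ball 0 1"
    and bound: "\<And>z. z \<in> ball 0 1 \<Longrightarrow> cmod (f z) < M"
  shows "M * cmod (deriv f 0) \<le> M\<^sup>2 - (cmod (f 0))\<^sup>2"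
proof -
  have M: "0 < M"
    using bound[of 0] norm_ge_zero[of "f 0"] by (simp del: norm_ge_zero)
  define a where "a = f 0 / of_real M"
  define h where "h z = Moebius_function 0 a (f z / of_real M)" for z
  have a: "cmod a < 1"
    using bound[of 0] M by (simp add: a_def norm_divide)
  have aa: "1 - cnj a * a = of_real (1 - (cmod a)\<^sup>2)"
    by (simp only: of_real_diff of_real_1 complex_norm_square mult.commute)
  have pos: "0 < 1 - (cmod a)\<^sup>2"
    using a by (simp add: power_less_one_iff)
  have scaled: "cmod (f z / of_real M) < 1" if "z \<in> ball 0 1" for z
    using bound[OF that] M by (simp add: norm_divide)
  have "(Moebius_function 0 a \<circ> (\<lambda>z. f z / of_real M)) holomorphic_on ball 0 1"
    by (rule holomorphic_on_compose_gen[OF _ Moebius_function_holomorphic[OF a]])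
       (use hol M scaled in \<open>auto intro!: holomorphic_intros\<close>)
  then have "h holomorphic_on ball 0 1"
    by (simp add: h_def[abs_def] o_def)
  moreover have "h 0 = 0"
    by (simp add: h_def a_def Moebius_function_eq_zero)
  moreover have "cmod (h z) < 1" if "cmod z < 1" for z
    using Moebius_function_norm_lt_1[OF a scaled] that by (simp add: h_def)
  ultimately have "cmod (deriv h 0) \<le> 1"
    using Schwarz_Lemma(2)[of h 0] by simp
  moreover have "deriv h 0 = deriv f 0 / of_real M / (1 - cnj a * a)"
  proof (rule DERIV_imp_deriv)
    have df: "(f has_field_derivative deriv f 0) (at 0)"
      using hol by (intro holomorphic_derivI[of f "ball 0 1"]) auto
    have nz: "1 - cnj a * a \<noteq> 0"
      unfolding aa using pos by (simp del: of_real_diff)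
    have "(Moebius_function 0 a has_field_derivative (1 - cnj a * a) / (1 - cnj a * a)\<^sup>2)
        (at (f 0 / of_real M))"
      using Moebius_function_has_field_derivative[OF nz] by (simp add: a_def)
    from DERIV_chain2[OF this DERIV_cdivide[OF df]]
    show "(h has_field_derivative deriv f 0 / of_real M / (1 - cnj a * a)) (at 0)"
      using nz by (simp add: h_def[abs_def] power2_eq_square mult.commute)
  qed
  moreover have "cmod (1 - cnj a * a) = 1 - (cmod a)\<^sup>2"
    unfolding aa norm_of_real using pos by simp
  moreover note pos
  ultimately have "cmod (deriv f 0) / M \<le> 1 - (cmod a)\<^sup>2"
    using M by (simp add: norm_divide norm_mult pos_divide_le_eq mult.commute)
  then have "M * (M * (cmod (deriv f 0) / M)) \<le> M * (M * (1 - (cmod a)\<^sup>2))"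
    using M by (intro mult_left_mono) auto
  then show ?thesis
    using M by (simp add: a_def norm_divide power2_eq_square algebra_simps)
qed

lemma toeplitz2_inverse:
  assumes "a \<noteq> 0"
  shows "toeplitz2 a b ** toeplitz2 (1 / a) (- b / a\<^sup>2) = mat 1"
    and "toeplitz2 (1 / a) (- b / a\<^sup>2) ** toeplitz2 a b = mat 1"
  using assms by (simp_all add: toeplitz2_mult mat_eq_toeplitz2 power2_eq_square)

lemma invertible_toeplitz2: "a \<noteq> 0 \<Longrightarrow> invertible (toeplitz2 a b)"
  unfolding invertible_def using toeplitz2_inverse by blast

lemma matrix_inv_toeplitz2:
  assumes "a \<noteq> 0"
  shows "matrix_inv (toeplitz2 a b) = toeplitz2 (1 / a) (- b / a\<^sup>2)" (is "matrix_inv ?T = ?S")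
proof -
  have "matrix_inv ?T ** ?T = mat 1"
    using invertible_toeplitz2[OF assms, of b]
    unfolding matrix_inv_def invertible_def by (rule someI2_ex) simp
  then have "matrix_inv ?T ** (?T ** ?S) = ?S"
    by (simp add: matrix_mul_assoc)
  then show ?thesis by (simp only: toeplitz2_inverse(1)[OF assms] matrix_mul_rid)
qed

lemma max_mod_upper:
  assumes "compact S" and "continuous_on S f" and "z \<in> S"
  shows "cmod (f z) \<le> max_mod S f"
  unfolding max_mod_def
proof (rule cSUP_upper)
  have "compact ((\<lambda>z. cmod (f z)) ` S)"
    using assms by (intro compact_continuous_image continuous_intros)
  then show "bdd_above ((\<lambda>z. cmod (f z)) ` S)"
    by (intro bounded_imp_bdd_above compact_imp_bounded)
qed fact

text \<open>
  Let \<open>\<psi>\<close> be the Moebius map of the unit disc onto the given disc with \<open>\<psi> 0 = 0\<close>. The relation between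
  \<open>s\<close> and \<open>t\<close> gives \<open>\<psi>' 0 = s\<close>, so for \<open>f = p / q\<close> the matrix \<open>f(N)\<close> has diagonal \<open>f 0 = (f \<circ> \<psi>) 0\<close>
  and corner \<open>s f' 0 = (f \<circ> \<psi>)' 0\<close>. The Schwarz-Pick inequality for \<open>f \<circ> \<psi>\<close> is then exactly the
  condition under which the norm of this matrix is at most \<open>M\<close>.
\<close>

lemma spectral_set_disk:
  fixes s t :: real
  assumes s: "0 < s" and st: "s\<^sup>2 + (s * t)\<^sup>2 = 1"
  shows "spectral_set (cball (\<i> * of_real t) (1 / s)) (toeplitz2 0 (of_real s))"
  unfolding spectral_set_def
proof (intro conjI allI impI)
  let ?D = "cball (\<i> * complex_of_real t) (1 / s)"
  let ?N = "toeplitz2 0 (of_real s)"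
  show "compact ?D" by (rule compact_cball)
  define w where "w = \<i> * complex_of_real (s * t)"
  have "(cmod w)\<^sup>2 < 1"
    using st s by (simp add: w_def norm_mult power_mult_distrib) (metis less_add_same_cancel2 zero_less_power)
  then have w: "cmod w < 1"
    by (simp add: power_less_one_iff)
  define \<psi> where "\<psi> z = \<i> * of_real t + Moebius_function 0 w z / of_real s" for z
  have \<psi>_in: "\<psi> z \<in> ?D" if "z \<in> ball 0 1" for z
    using Moebius_function_norm_lt_1[OF w, of z 0] that s
    by (simp add: \<psi>_def dist_norm norm_divide divide_right_mono)
  have \<psi>0: "\<psi> 0 = 0"
    using s by (simp add: \<psi>_def Moebius_function_of_zero w_def)
  have hol\<psi>: "\<psi> holomorphic_on ball 0 1"
    unfolding \<psi>_def using s by (intro holomorphic_intros Moebius_function_holomorphic w) auto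
  have d\<psi>: "(\<psi> has_field_derivative of_real s) (at 0)"
  proof -
    have "complex_of_real (s\<^sup>2 + (s * t)\<^sup>2) = 1"
      using st by simp
    then have "of_real s * of_real s = 1 - cnj w * w"
      by (simp add: w_def power2_eq_square algebra_simps)
    moreover have "(\<psi> has_field_derivative 0 + (1 - cnj w * w) / (1 - cnj w * 0)\<^sup>2 / of_real s) (at 0)"
      unfolding \<psi>_def
      by (intro DERIV_add DERIV_const DERIV_cdivide Moebius_function_has_field_derivative) simp
    then have "(\<psi> has_field_derivative (1 - cnj w * w) / of_real s) (at 0)"
      by simp
    ultimately show ?thesis using s by (metis nonzero_mult_div_cancel_right of_real_eq_0_iff less_irrefl)
  qed
  have zero_in: "0 \<in> ?D"
    using \<psi>_in[of 0] \<psi>0 by simp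
  show "{z. \<not> invertible (?N - mat z)} \<subseteq> ?D"
  proof clarify
    fix z assume "\<not> invertible (?N - mat z)"
    then have "z = 0"
      using invertible_toeplitz2[of "- z" "of_real s"]
      by (auto simp: mat_eq_toeplitz2 toeplitz2_diff)
    then show "z \<in> ?D" using zero_in by simp
  qed
  fix p q :: "complex poly"
  assume q: "\<forall>z\<in>?D. poly q z \<noteq> 0"
  define f where "f z = poly p z / poly q z" for z
  let ?a = "poly p 0" and ?a' = "poly (pderiv p) 0" and ?b = "poly q 0" and ?b' = "poly (pderiv q) 0"
  have b: "?b \<noteq> 0"
    using q zero_in by blast
  have prod: "mat_poly p ?N ** matrix_inv (mat_poly q ?N)
      = toeplitz2 (f 0) (of_real s * ((?a' * ?b - ?a * ?b') / ?b\<^sup>2))"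
    using b by (simp add: mat_poly_nilpotent_toeplitz2 matrix_inv_toeplitz2 toeplitz2_mult f_def
        power2_eq_square diff_divide_distrib algebra_simps)
  have holf: "f holomorphic_on ?D"
    unfolding f_def using q by (intro holomorphic_intros) auto
  have df: "(f has_field_derivative (?a' * ?b - ?a * ?b') / ?b\<^sup>2) (at 0)"
    unfolding f_def by (rule derivative_eq_intros refl poly_DERIV)+ (use b in \<open>auto simp: power2_eq_square algebra_simps\<close>)
  have dg: "deriv (f \<circ> \<psi>) 0 = (?a' * ?b - ?a * ?b') / ?b\<^sup>2 * of_real s"
    using df d\<psi> \<psi>0 by (intro DERIV_imp_deriv DERIV_chain) simp_all
  \<comment> \<open>A bound strictly above the maximum keeps \<open>f\<close> inside the open disc of radius \<open>M\<close>, as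
    Schwarz-Pick needs, even if \<open>f\<close> is constant.\<close>
  have "mat_norm (mat_poly p ?N ** matrix_inv (mat_poly q ?N)) \<le> M" if M: "max_mod ?D f < M" for M
    unfolding prod
  proof (rule mat_norm_toeplitz2_le)
    have f_less: "cmod (f z) < M" if "z \<in> ?D" for z
      using max_mod_upper[OF compact_cball holomorphic_on_imp_continuous_on[OF holf] that] M
      by (rule le_less_trans)
    show "0 < M"
      using f_less[OF zero_in] norm_ge_zero[of "f 0"] by linarith
    have "M * cmod (deriv (f \<circ> \<psi>) 0) \<le> M\<^sup>2 - (cmod ((f \<circ> \<psi>) 0))\<^sup>2"
    proof (rule Schwarz_Pick_at_0)
      show "(f \<circ> \<psi>) holomorphic_on ball 0 1"
        by (rule holomorphic_on_compose_gen[OF hol\<psi> holf]) (use \<psi>_in in blast)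
    qed (use f_less \<psi>_in in \<open>simp add: o_def\<close>)
    then show "M * cmod (of_real s * ((?a' * ?b - ?a * ?b') / ?b\<^sup>2)) \<le> M\<^sup>2 - (cmod (f 0))\<^sup>2"
      by (simp add: dg \<psi>0 mult.commute)
  qed
  then show "mat_norm (mat_poly p ?N ** matrix_inv (mat_poly q ?N))
      \<le> max_mod ?D (\<lambda>z. poly p z / poly q z)"
    unfolding f_def[symmetric] by (rule dense_ge)
qed

section \<open>Uniform approximation by polynomials\<close>

definition poly_approximable :: "complex set \<Rightarrow> (complex \<Rightarrow> complex) \<Rightarrow> bool" where
  "poly_approximable K f \<longleftrightarrow> (\<forall>\<epsilon>>0. \<exists>p. \<forall>z\<in>K. cmod (poly p z - f z) < \<epsilon>)"

lemma poly_approximable_poly: "poly_approximable K (poly p)"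
  unfolding poly_approximable_def by (auto intro!: exI[of _ p])

text \<open>
  Only the values of \<open>g\<close> on the image of \<open>f\<close> matter, not those on a neighbourhood: \<open>g\<close> is first
  replaced by a polynomial \<open>q\<close>, and \<open>q\<close> is uniformly continuous on a disc around that image. So
  approximability passes along chains of maps, each of which needs to be approximated only on
  the image of the one before.
\<close>

lemma poly_approximable_compose:
  assumes f: "poly_approximable K f" and bdd: "bounded (f ` K)"
    and g: "poly_approximable (f ` K) g"
  shows "poly_approximable K (g \<circ> f)"
  unfolding poly_approximable_def
proof (intro allI impI)
  fix \<epsilon> :: real assume "0 < \<epsilon>"
  with g obtain q where q: "\<And>z. z \<in> K \<Longrightarrow> cmod (poly q (f z) - g (f z)) < \<epsilon> / 2"
    unfolding poly_approximable_def by (metis half_gt_zero imageI)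
  from bdd obtain B where B: "\<And>z. z \<in> K \<Longrightarrow> cmod (f z) \<le> B"
    unfolding bounded_iff by auto
  have "uniformly_continuous_on (cball 0 (B + 1)) (poly q)"
    by (intro compact_uniformly_continuous continuous_intros compact_cball)
  then obtain \<delta> where "0 < \<delta>"
    and \<delta>: "\<And>x y. \<lbrakk>x \<in> cball 0 (B + 1); y \<in> cball 0 (B + 1); dist x y < \<delta>\<rbrakk>
      \<Longrightarrow> dist (poly q x) (poly q y) < \<epsilon> / 2"
    unfolding uniformly_continuous_on_def using \<open>0 < \<epsilon>\<close> by (metis dist_commute half_gt_zero)
  from f \<open>0 < \<delta>\<close> obtain p where p: "\<And>z. z \<in> K \<Longrightarrow> cmod (poly p z - f z) < min \<delta> 1"
    unfolding poly_approximable_def by (metis min_less_iff_conj zero_less_one)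
  show "\<exists>r. \<forall>z\<in>K. cmod (poly r z - (g \<circ> f) z) < \<epsilon>"
  proof (intro exI ballI)
    fix z assume z: "z \<in> K"
    have "cmod (poly p z) \<le> B + 1"
      using norm_triangle_ineq[of "poly p z - f z" "f z"] p[OF z] B[OF z] by simp
    then have "cmod (poly q (poly p z) - poly q (f z)) < \<epsilon> / 2"
      using \<delta>[of "poly p z" "f z"] p[OF z] B[OF z] by (simp add: dist_norm)
    then show "cmod (poly (q \<circ>\<^sub>p p) z - (g \<circ> f) z) < \<epsilon>"
      using norm_triangle_ineq[of "poly q (poly p z) - poly q (f z)" "poly q (f z) - g (f z)"] q[OF z]
      by (simp add: poly_pcompose)
  qed
qed

lemma poly_approximable_holomorphic_ball:
  assumes hol: "f holomorphic_on ball c R" and "r < R" and K: "K \<subseteq> cball c r"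
  shows "poly_approximable K f"
proof (cases "0 \<le> r")
  case False
  with K have "K = {}" by auto
  then show ?thesis by (simp add: poly_approximable_def)
next
  case True
  define a where "a n = (deriv ^^ n) f c / fact n" for n
  have sums: "(\<lambda>n. a n * (z - c) ^ n) sums f z" if "z \<in> ball c R" for z
    unfolding a_def by (rule holomorphic_power_series[OF hol that])
  obtain s where s: "r < s" "s < R" using \<open>r < R\<close> dense by blast
  have "ereal s \<le> conv_radius a"
  proof -
    have "summable (\<lambda>n. a n * of_real s ^ n)"
      using sums[of "c + of_real s"] s True by (auto simp: dist_norm sums_iff)
    from conv_radius_geI[OF this] show ?thesis using s True by simp
  qed
  then have "ereal r < conv_radius a"
    using s less_le_trans[of "ereal r" "ereal s"] by simp
  note lim = powser_uniform_limit[OF this, of c]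
  show ?thesis
    unfolding poly_approximable_def
  proof (intro allI impI)
    fix \<epsilon> :: real assume "0 < \<epsilon>"
    with lim obtain n where n: "\<And>z. z \<in> cball c r \<Longrightarrow>
        dist (\<Sum>i<n. a i * (z - c) ^ i) (\<Sum>i. a i * (z - c) ^ i) < \<epsilon>"
      unfolding uniform_limit_sequentially_iff by blast
    define p where "p = (\<Sum>i<n. Polynomial.smult (a i) ([:- c, 1:] ^ i))"
    show "\<exists>p. \<forall>z\<in>K. cmod (poly p z - f z) < \<epsilon>"
    proof (intro exI ballI)
      fix z assume "z \<in> K"
      with K have z: "z \<in> cball c r" by blast
      with s have "z \<in> ball c R" by auto
      from sums_unique[OF sums[OF this]] n[OF z]
      show "cmod (poly p z - f z) < \<epsilon>"
        by (simp add: p_def poly_sum poly_power dist_norm)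
    qed
  qed
qed

text \<open>
  The disc \<open>cball R R\<close> is given by \<open>\<bar>w\<bar>\<^sup>2 \<le> 2 R Re w\<close>, so \<open>R\<close> is taken to be the maximum of
  \<open>\<bar>w\<bar>\<^sup>2 / (2 Re w)\<close> over \<open>K\<close>.
\<close>

lemma compact_right_halfplane_subset_cball:
  assumes "compact K" and "\<And>w. w \<in> K \<Longrightarrow> 0 < Re w"
  obtains R where "0 < R" and "K \<subseteq> cball (of_real R) R"
proof (cases "K = {}")
  case True then show ?thesis using that[of 1] by simp
next
  case False
  have "continuous_on K (\<lambda>w. (cmod w)\<^sup>2 / (2 * Re w))"
    using assms(2) by (intro continuous_intros) force
  from continuous_attains_sup[OF assms(1) False this]
  obtain w0 where w0: "w0 \<in> K"
    and le: "\<And>w. w \<in> K \<Longrightarrow> (cmod w)\<^sup>2 / (2 * Re w) \<le> (cmod w0)\<^sup>2 / (2 * Re w0)" by blast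
  define R where "R = (cmod w0)\<^sup>2 / (2 * Re w0)"
  have "w0 \<noteq> 0" using assms(2)[OF w0] by auto
  then have R: "0 < R" using assms(2)[OF w0] by (simp add: R_def)
  moreover have "K \<subseteq> cball (of_real R) R"
  proof
    fix w assume w: "w \<in> K"
    have "(cmod w)\<^sup>2 \<le> 2 * R * Re w"
      using le[OF w] assms(2)[OF w] unfolding R_def[symmetric] by (simp add: pos_divide_le_eq mult_ac)
    then have "(cmod (w - of_real R))\<^sup>2 \<le> R\<^sup>2"
      by (simp add: cmod_power2) (simp add: power2_eq_square algebra_simps)
    then show "w \<in> cball (of_real R) R"
      using R by (simp add: dist_norm norm_minus_commute abs_le_square_iff[symmetric])
  qed
  ultimately show ?thesis by (rule that)
qed

section \<open>The conformal map of the lens\<close>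

lemma sin_pos_cot_nonneg:
  assumes "0 < \<alpha>" and "\<alpha> \<le> pi / 2"
  shows "0 < sin \<alpha>" and "0 \<le> cot \<alpha>"
proof -
  show "0 < sin \<alpha>"
    using assms by (intro sin_gt_zero) auto
  then show "0 \<le> cot \<alpha>"
    using assms cos_ge_zero[of \<alpha>] by (simp add: cot_def)
qed

lemma inverse_sin_square: "sin \<alpha> \<noteq> 0 \<Longrightarrow> (1 / sin \<alpha>)\<^sup>2 = (cot \<alpha>)\<^sup>2 + (1 :: real)"
  using sin_cos_squared_add2[of \<alpha>] by (simp add: cot_def power_divide divide_simps)

lemma disk_plus_eq_cball: "disk_plus \<alpha> = cball (\<i> * of_real (cot \<alpha>)) (1 / sin \<alpha>)"
  by (auto simp: disk_plus_def dist_norm norm_minus_commute)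

lemma disk_minus_eq_cball: "disk_minus \<alpha> = cball (\<i> * of_real (- cot \<alpha>)) (1 / sin \<alpha>)"
proof -
  have "dist (\<i> * of_real (- cot \<alpha>)) z = cmod (z - \<i> * of_real (- cot \<alpha>))" for z
    by (metis dist_commute dist_norm)
  then show ?thesis by (simp add: disk_minus_def cball_def)
qed

lemma compact_lens: "compact (lens \<alpha>)"
  unfolding lens_def disk_plus_eq_cball disk_minus_eq_cball by (intro compact_Int compact_cball)

text \<open>
  Since \<open>csc\<^sup>2 \<alpha> = 1 + cot\<^sup>2 \<alpha>\<close>, expanding the squares in the two disc conditions cancels
  \<open>cot\<^sup>2 \<alpha>\<close>. In this form it is plain that the lens lies in the closed unit disc and that
  shrinking makes the inequality strict.
\<close>

lemma mem_lens_iff: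
  assumes "0 < \<alpha>" and "\<alpha> \<le> pi / 2"
  shows "z \<in> lens \<alpha> \<longleftrightarrow> (cmod z)\<^sup>2 + 2 * cot \<alpha> * \<bar>Im z\<bar> \<le> 1"
proof -
  note s = sin_pos_cot_nonneg(1)[OF assms] and c = sin_pos_cot_nonneg(2)[OF assms]
  have disk: "cmod (z - \<i> * of_real t) \<le> 1 / sin \<alpha> \<longleftrightarrow> (cmod z)\<^sup>2 - 2 * t * Im z \<le> 1"
    if "t\<^sup>2 = (cot \<alpha>)\<^sup>2" for t :: real
  proof -
    have "cmod (z - \<i> * of_real t) \<le> 1 / sin \<alpha>
        \<longleftrightarrow> (cmod (z - \<i> * of_real t))\<^sup>2 \<le> (1 / sin \<alpha>)\<^sup>2"
      using s by (simp flip: abs_le_square_iff)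
    also have "(cmod (z - \<i> * of_real t))\<^sup>2 = (cmod z)\<^sup>2 - 2 * t * Im z + t\<^sup>2"
      by (simp add: cmod_power2) (simp add: power2_eq_square algebra_simps)
    finally show ?thesis using that s by (simp add: inverse_sin_square)
  qed
  have "z \<in> lens \<alpha> \<longleftrightarrow> (cmod z)\<^sup>2 - 2 * cot \<alpha> * Im z \<le> 1 \<and> (cmod z)\<^sup>2 + 2 * cot \<alpha> * Im z \<le> 1"
    using disk[of "cot \<alpha>"] disk[of "- cot \<alpha>"] by (simp add: lens_def disk_plus_def disk_minus_def)
  also have "\<dots> \<longleftrightarrow> (cmod z)\<^sup>2 + 2 * cot \<alpha> * \<bar>Im z\<bar> \<le> 1"
  proof -
    have "0 \<le> cot \<alpha> * \<bar>Im z\<bar>" using c by simp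
    then show ?thesis by (cases "0 \<le> Im z") auto
  qed
  finally show ?thesis .
qed

lemma cball_subset_lens:
  assumes "0 < \<alpha>" and "\<alpha> \<le> pi / 2"
  obtains \<rho> where "0 < \<rho>" and "cball 0 \<rho> \<subseteq> lens \<alpha>"
proof
  note c = sin_pos_cot_nonneg(2)[OF assms]
  \<comment> \<open>As \<open>\<rho> \<le> 1\<close>, the defining expression is at most \<open>\<rho>\<^sup>2 + 2 \<rho> cot \<alpha> \<le> \<rho> (1 + 2 cot \<alpha>) = 1\<close>.\<close>
  define \<rho> where "\<rho> = 1 / (1 + 2 * cot \<alpha>)"
  show \<rho>: "0 < \<rho>" using c by (simp add: \<rho>_def)
  show "cball 0 \<rho> \<subseteq> lens \<alpha>"
  proof
    fix z :: complex assume "z \<in> cball 0 \<rho>"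
    then have z: "cmod z \<le> \<rho>" by simp
    have "\<rho> \<le> 1" using c by (simp add: \<rho>_def)
    then have "(cmod z)\<^sup>2 \<le> \<rho>"
      using mult_mono[of "cmod z" \<rho> "cmod z" 1] z \<rho> by (simp add: power2_eq_square)
    moreover have "2 * cot \<alpha> * \<bar>Im z\<bar> \<le> 2 * cot \<alpha> * \<rho>"
      using c z abs_Im_le_cmod[of z] by (intro mult_left_mono) auto
    moreover have "\<rho> + 2 * cot \<alpha> * \<rho> = \<rho> * (1 + 2 * cot \<alpha>)"
      by (simp add: algebra_simps)
    then have "\<rho> + 2 * cot \<alpha> * \<rho> = 1"
      using c by (simp add: \<rho>_def)
    ultimately show "z \<in> lens \<alpha>"
      unfolding mem_lens_iff[OF assms] by linarith
  qed
qed

text \<open>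
  This is \<open>2 artanh z\<close>, the logarithm of \<open>(1 + z) / (1 - z)\<close>.
\<close>

definition strip_coord :: "complex \<Rightarrow> complex" where
  "strip_coord z = Ln (1 + z) - Ln (1 - z)"

lemma Re_one_pm_pos: "cmod z < 1 \<Longrightarrow> 0 < Re (1 + z) \<and> 0 < Re (1 - z)"
  using abs_Re_le_cmod[of z] by auto

lemma strip_coord_holomorphic: "strip_coord holomorphic_on ball 0 1"
proof -
  have "1 + z \<notin> \<real>\<^sub>\<le>\<^sub>0" "1 - z \<notin> \<real>\<^sub>\<le>\<^sub>0" if "cmod z < 1" for z
    using Re_one_pm_pos[OF that] by (auto simp: complex_nonpos_Reals_iff)
  then show ?thesis
    unfolding strip_coord_def by (intro holomorphic_intros) auto
qed

text \<open>
  The strict lens inequality describes the interior of the lens. It is mapped into a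
  strip because \<open>(1 + z) / (1 - z)\<close> is a positive multiple of \<open>1 - \<bar>z\<bar>\<^sup>2 + 2 \<i> Im z\<close>, and the
  hypothesis says precisely that this number lies in the open sector of half-angle \<open>\<alpha>\<close>.
\<close>

lemma abs_Im_strip_coord_less:
  assumes "0 < \<alpha>" and "\<alpha> \<le> pi / 2" and z: "(cmod z)\<^sup>2 + 2 * cot \<alpha> * \<bar>Im z\<bar> < 1"
  shows "\<bar>Im (strip_coord z)\<bar> < \<alpha>"
proof -
  note s = sin_pos_cot_nonneg(1)[OF assms(1,2)] and c = sin_pos_cot_nonneg(2)[OF assms(1,2)]
  have "0 \<le> 2 * cot \<alpha> * \<bar>Im z\<bar>"
    using c by simp
  with z have "(cmod z)\<^sup>2 < 1"
    by linarith
  then have z1: "cmod z < 1" by (simp add: power_less_one_iff)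
  define \<theta> where "\<theta> = Im (strip_coord z)"
  define e where "e = exp (Re (strip_coord z))"
  define k where "k = (cmod (1 - z))\<^sup>2"
  have nz: "1 + z \<noteq> 0" "1 - z \<noteq> 0"
    using Re_one_pm_pos[OF z1] by (metis less_irrefl zero_complex.simps(1))+
  have e: "0 < e" and k: "0 < k" using nz by (simp_all add: e_def k_def)
  have "exp (strip_coord z) * (1 - z) = 1 + z"
    using nz by (simp add: strip_coord_def exp_diff)
  then have "exp (strip_coord z) * ((1 - z) * cnj (1 - z)) = (1 + z) * cnj (1 - z)"
    by (simp only: mult.assoc[symmetric])
  then have eq: "exp (strip_coord z) * of_real k = (1 + z) * cnj (1 - z)"
    by (simp only: k_def complex_norm_square)
  have "e * cos \<theta> * k = 1 - (cmod z)\<^sup>2"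
    using arg_cong[OF eq, of Re]
    unfolding cmod_power2 by (simp add: Re_exp e_def \<theta>_def power2_eq_square algebra_simps)
  moreover have "e * sin \<theta> * k = 2 * Im z"
    using arg_cong[OF eq, of Im]
    by (simp add: Im_exp e_def \<theta>_def algebra_simps)
  moreover have "cot \<alpha> * (2 * \<bar>Im z\<bar>) < 1 - (cmod z)\<^sup>2"
    using z by (simp add: mult_ac)
  ultimately have "cot \<alpha> * (e * \<bar>sin \<theta>\<bar> * k) < e * cos \<theta> * k"
    using e k by (metis abs_mult abs_numeral abs_of_pos)
  then have "(e * k) * (cot \<alpha> * \<bar>sin \<theta>\<bar>) < (e * k) * cos \<theta>"
    by (simp add: mult_ac)
  then have "cot \<alpha> * \<bar>sin \<theta>\<bar> < cos \<theta>"
    using e k by (simp add: mult_less_cancel_left_pos)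
  then have main: "\<bar>sin \<theta>\<bar> * cos \<alpha> < cos \<theta> * sin \<alpha>"
    using s by (simp add: cot_def pos_divide_less_eq mult_ac)
  \<comment> \<open>The sector condition determines \<open>\<theta>\<close> only up to multiples of \<open>2 \<pi>\<close>; this bound removes the
    ambiguity.\<close>
  have "\<bar>Im (Ln (1 + z))\<bar> < pi / 2" "\<bar>Im (Ln (1 - z))\<bar> < pi / 2"
    using Re_one_pm_pos[OF z1] Re_Ln_pos_lt[OF nz(1)] Re_Ln_pos_lt[OF nz(2)] by simp_all
  then have \<theta>_pi: "\<bar>\<theta>\<bar> < pi"
    by (simp add: \<theta>_def strip_coord_def)
  have "\<bar>sin \<theta>\<bar> = sin \<bar>\<theta>\<bar>"
  proof (cases "0 \<le> \<theta>")
    case True then show ?thesis using \<theta>_pi by (simp add: sin_ge_zero)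
  next
    case False then show ?thesis using \<theta>_pi sin_ge_zero[of "- \<theta>"] by simp
  qed
  then have "sin (\<bar>\<theta>\<bar> - \<alpha>) < 0"
    using main by (simp add: sin_diff)
  show ?thesis
  proof (rule ccontr)
    assume "\<not> \<bar>Im (strip_coord z)\<bar> < \<alpha>"
    then have "0 \<le> sin (\<bar>\<theta>\<bar> - \<alpha>)"
      using \<theta>_pi assms by (intro sin_ge_zero) (auto simp: \<theta>_def)
    with \<open>sin (\<bar>\<theta>\<bar> - \<alpha>) < 0\<close> show False by simp
  qed
qed

text \<open>
  The branch of \<open>((1 + z) / (1 - z)) ^ \<beta>\<close> with value 1 at 0.
\<close>

definition sector_map :: "real \<Rightarrow> complex \<Rightarrow> complex" where
  "sector_map \<beta> z = exp (of_real \<beta> * strip_coord z)"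

definition cayley :: "complex \<Rightarrow> complex" where
  "cayley w = (w - 1) / (w + 1)"

text \<open>
  The shrinking factor \<open>r < 1\<close> moves the lens away from its boundary, which the sector map takes to
  the imaginary axis, and in particular from \<open>1\<close> and \<open>-1\<close>, where the logarithms are singular.
\<close>

context
  fixes \<alpha> r :: real
  assumes \<alpha>: "0 < \<alpha>" "\<alpha> \<le> pi / 2" and r: "0 \<le> r" "r < 1"
begin

abbreviation "shrunk_lens \<equiv> (\<lambda>z. of_real r * z) ` lens \<alpha>"

lemma shrunk_lens_strict:
  assumes "z \<in> lens \<alpha>"
  shows "(cmod (of_real r * z))\<^sup>2 + 2 * cot \<alpha> * \<bar>Im (of_real r * z)\<bar> < 1"
proof -
  define x where "x = (cmod z)\<^sup>2 + 2 * cot \<alpha> * \<bar>Im z\<bar>"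
  have "(cmod (of_real r * z))\<^sup>2 \<le> r * (cmod z)\<^sup>2"
    using r mult_right_mono[of r 1 "r * (cmod z)\<^sup>2"]
    by (simp add: norm_mult power_mult_distrib power2_eq_square[of r] mult_ac)
  then have "(cmod (of_real r * z))\<^sup>2 + 2 * cot \<alpha> * \<bar>Im (of_real r * z)\<bar> \<le> r * x"
    using r by (simp add: x_def abs_mult algebra_simps)
  also have "\<dots> < 1"
    using assms \<alpha> r mult_left_mono[of x 1 r] by (simp add: mem_lens_iff x_def)
  finally show ?thesis .
qed

lemma shrunk_lens_subset: "shrunk_lens \<subseteq> cball 0 r"
proof clarsimp
  fix z assume z: "z \<in> lens \<alpha>"
  have "0 \<le> 2 * cot \<alpha> * \<bar>Im z\<bar>" using sin_pos_cot_nonneg(2)[OF \<alpha>] by simp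
  then have "(cmod z)\<^sup>2 \<le> 1" using z mem_lens_iff[OF \<alpha>, of z] by linarith
  then have "cmod z \<le> 1" by (simp add: power_le_one_iff)
  then show "cmod (of_real r * z) \<le> r" using r by (simp add: norm_mult mult_left_le)
qed

lemma Re_sector_map_pos:
  assumes "\<zeta> \<in> shrunk_lens"
  shows "0 < Re (sector_map (pi / (2 * \<alpha>)) \<zeta>)"
proof -
  have "\<bar>Im (strip_coord \<zeta>)\<bar> < \<alpha>"
    using assms shrunk_lens_strict by (auto intro!: abs_Im_strip_coord_less \<alpha>)
  then have "pi / (2 * \<alpha>) * \<bar>Im (strip_coord \<zeta>)\<bar> < pi / (2 * \<alpha>) * \<alpha>"
    using \<alpha> by (intro mult_strict_left_mono) auto
  then have bound: "\<bar>pi / (2 * \<alpha>) * Im (strip_coord \<zeta>)\<bar> < pi / 2"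
    using \<alpha> by (simp add: abs_mult)
  have "0 < cos (pi / (2 * \<alpha>) * Im (strip_coord \<zeta>))"
    using bound by (intro cos_gt_zero_pi) linarith+
  then show ?thesis
    by (simp add: sector_map_def Re_exp)
qed

lemma sector_map_holomorphic: "sector_map \<beta> holomorphic_on ball 0 1"
  unfolding sector_map_def by (intro holomorphic_intros strip_coord_holomorphic)

text \<open>
  For \<open>r = 1\<close> this would be the Riemann map of the interior of the lens onto the unit disc.
\<close>

definition lens_map :: "complex \<Rightarrow> complex" where
  "lens_map z = cayley (sector_map (pi / (2 * \<alpha>)) (of_real r * z))"

lemma lens_map_holomorphic: "lens_map holomorphic_on lens \<alpha>"
proof -
  have "(sector_map (pi / (2 * \<alpha>)) \<circ> (\<lambda>z. of_real r * z)) holomorphic_on lens \<alpha>"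
    using shrunk_lens_subset r
    by (intro holomorphic_on_compose_gen[OF _ sector_map_holomorphic] holomorphic_intros) auto
  then have "(\<lambda>z. sector_map (pi / (2 * \<alpha>)) (of_real r * z)) holomorphic_on lens \<alpha>"
    by (simp add: o_def)
  moreover have "sector_map (pi / (2 * \<alpha>)) (of_real r * z) + 1 \<noteq> 0" if "z \<in> lens \<alpha>" for z
  proof
    assume "sector_map (pi / (2 * \<alpha>)) (of_real r * z) + 1 = 0"
    from arg_cong[OF this, of Re] Re_sector_map_pos[OF imageI[OF that]] show False by simp
  qed
  ultimately show ?thesis
    unfolding lens_map_def cayley_def by (intro holomorphic_intros) auto
qed

lemma norm_lens_map_le_1:
  assumes "z \<in> lens \<alpha>"
  shows "cmod (lens_map z) \<le> 1"
proof -
  define W where "W = sector_map (pi / (2 * \<alpha>)) (of_real r * z)"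
  have "0 < Re W"
    unfolding W_def using assms by (intro Re_sector_map_pos) auto
  then have "(cmod (W - 1))\<^sup>2 \<le> (cmod (W + 1))\<^sup>2"
    unfolding cmod_power2 by (simp add: power2_eq_square algebra_simps)
  then have "cmod (W - 1) \<le> cmod (W + 1)"
    by (rule power2_le_imp_le) simp
  then show ?thesis
    by (simp add: lens_map_def cayley_def W_def[symmetric] norm_divide divide_le_eq_1)
qed

lemma lens_map_0: "lens_map 0 = 0"
  by (simp add: lens_map_def cayley_def sector_map_def strip_coord_def)

lemma lens_map_has_field_derivative_0:
  "(lens_map has_field_derivative of_real (r * (pi / (2 * \<alpha>)))) (at 0)"
proof -
  have "(strip_coord has_field_derivative 2) (at 0)"
    unfolding strip_coord_def by (auto intro!: derivative_eq_intros)
  moreover have "strip_coord 0 = 0"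
    by (simp add: strip_coord_def)
  ultimately have "(sector_map (pi / (2 * \<alpha>)) has_field_derivative of_real (pi / \<alpha>)) (at 0)"
    unfolding sector_map_def using \<alpha> by (auto intro!: derivative_eq_intros)
  moreover have "((\<lambda>z. of_real r * z) has_field_derivative of_real r) (at 0)"
    using DERIV_cmult_Id by blast
  ultimately have "((\<lambda>z. sector_map (pi / (2 * \<alpha>)) (of_real r * z)) has_field_derivative
      of_real (pi / \<alpha>) * of_real r) (at 0)"
    by (intro DERIV_chain2[where f = "sector_map _"]) simp_all
  moreover have "sector_map (pi / (2 * \<alpha>)) 0 = 1"
    by (simp add: sector_map_def strip_coord_def)
  moreover have "(cayley has_field_derivative 1 / 2) (at 1)"
    unfolding cayley_def by (auto intro!: derivative_eq_intros)
  ultimately have "(lens_map has_field_derivative 1 / 2 * (of_real (pi / \<alpha>) * of_real r)) (at 0)"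
    unfolding lens_map_def by (intro DERIV_chain2[where f = cayley]) simp_all
  then show ?thesis by (simp add: mult_ac)
qed

text \<open>
  A single power series does not do: for small \<open>\<alpha>\<close> and \<open>r\<close> close to 1 the map has poles inside the
  unit disc, and its Taylor series at 0 diverges near the ends of the lens. But it is a
  chain of four maps, each holomorphic on a disc that contains, with room to spare, the compact
  set on which it is needed: the scaling, \<open>strip_coord\<close> on a smaller concentric disc, an
  exponential on a bounded set, and the Cayley transform on a compact subset of the right
  half-plane. Taylor polynomials serve each link.
\<close>

lemma poly_approximable_lens_map: "poly_approximable (lens \<alpha>) lens_map"
proof -
  define \<beta> where "\<beta> = pi / (2 * \<alpha>)"
  define K1 K2 K3 where "K1 = shrunk_lens" and "K2 = strip_coord ` K1"
    and "K3 = (\<lambda>u. exp (of_real \<beta> * u)) ` K2"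
  have K1: "K1 \<subseteq> cball 0 r" unfolding K1_def by (rule shrunk_lens_subset)
  have c1: "compact K1"
    unfolding K1_def by (intro compact_continuous_image compact_lens continuous_intros)
  have "continuous_on K1 strip_coord"
    using K1 r by (intro continuous_on_subset[OF holomorphic_on_imp_continuous_on[OF strip_coord_holomorphic]]) auto
  then have c2: "compact K2"
    unfolding K2_def using c1 by (rule compact_continuous_image)
  have c3: "compact K3"
    unfolding K3_def using c2 by (intro compact_continuous_image continuous_intros)
  have K3_eq: "K3 = sector_map \<beta> ` K1"
    by (simp add: K3_def K2_def image_image sector_map_def)
  have a1: "poly_approximable (lens \<alpha>) (\<lambda>z. of_real r * z)"
  proof -
    have "(\<lambda>z :: complex. of_real r * z) = poly [:0, of_real r:]"
      by (simp add: fun_eq_iff)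
    then show ?thesis
      by (simp only: poly_approximable_poly)
  qed
  have a2: "poly_approximable K1 strip_coord"
    using strip_coord_holomorphic r(2) K1 by (rule poly_approximable_holomorphic_ball)
  have a3: "poly_approximable K2 (\<lambda>u. exp (of_real \<beta> * u))"
  proof -
    obtain B where "\<And>u. u \<in> K2 \<Longrightarrow> cmod u \<le> B"
      using compact_imp_bounded[OF c2] unfolding bounded_iff by auto
    then have "K2 \<subseteq> cball 0 B" by auto
    then show ?thesis
      by (intro poly_approximable_holomorphic_ball[of _ 0 "B + 1" B] holomorphic_intros) auto
  qed
  have a4: "poly_approximable K3 cayley"
  proof -
    have "\<And>w. w \<in> K3 \<Longrightarrow> 0 < Re w"
      unfolding K3_eq K1_def \<beta>_def using Re_sector_map_pos by blast
    from compact_right_halfplane_subset_cball[OF c3 this]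
    obtain R where R: "0 < R" "K3 \<subseteq> cball (of_real R) R" by blast
    \<comment> \<open>The pole of the Cayley transform is at distance exactly \<open>R + 1\<close> from the centre.\<close>
    have "w + 1 \<noteq> 0" if "w \<in> ball (of_real R) (R + 1)" for w :: complex
    proof
      assume "w + 1 = 0"
      then have "w = - 1" by (simp add: eq_neg_iff_add_eq_0)
      then have "dist (complex_of_real R) w = cmod (of_real (R + 1))"
        by (simp add: dist_norm)
      then show False using that R by (simp del: of_real_add)
    qed
    then have "cayley holomorphic_on ball (of_real R) (R + 1)"
      unfolding cayley_def by (intro holomorphic_intros) auto
    then show ?thesis
      by (rule poly_approximable_holomorphic_ball[OF _ _ R(2)]) simp
  qed
  have "poly_approximable K2 (cayley \<circ> (\<lambda>u. exp (of_real \<beta> * u)))"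
    by (rule poly_approximable_compose[OF a3 compact_imp_bounded[OF c3[unfolded K3_def]] a4[unfolded K3_def]])
  then have "poly_approximable K1 ((cayley \<circ> (\<lambda>u. exp (of_real \<beta> * u))) \<circ> strip_coord)"
    unfolding K2_def by (rule poly_approximable_compose[OF a2 compact_imp_bounded[OF c2[unfolded K2_def]]])
  then have "poly_approximable (lens \<alpha>)
      (((cayley \<circ> (\<lambda>u. exp (of_real \<beta> * u))) \<circ> strip_coord) \<circ> (\<lambda>z. of_real r * z))"
    unfolding K1_def by (rule poly_approximable_compose[OF a1 compact_imp_bounded[OF c1[unfolded K1_def]]])
  moreover have "((cayley \<circ> (\<lambda>u. exp (of_real \<beta> * u))) \<circ> strip_coord) \<circ> (\<lambda>z. of_real r * z) = lens_map"
    by (simp add: fun_eq_iff lens_map_def sector_map_def \<beta>_def)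
  ultimately show ?thesis by simp
qed

text \<open>
  Subtracting the value at 0 from an \<open>\<epsilon>\<close>-approximation costs another \<open>\<epsilon>\<close>, hence the factor 2. The
  derivative at 0 is controlled by Cauchy's inequality on a disc inside the lens.
\<close>

lemma exists_lens_polynomial:
  assumes \<epsilon>: "0 < \<epsilon>" and \<rho>: "0 < \<rho>" "cball 0 \<rho> \<subseteq> lens \<alpha>"
  shows "\<exists>p. poly p 0 = 0 \<and> (\<forall>z\<in>lens \<alpha>. cmod (poly p z) \<le> 1 + 2 * \<epsilon>)
    \<and> cmod (poly (pderiv p) 0 - of_real (r * (pi / (2 * \<alpha>)))) \<le> \<epsilon> / \<rho>"
proof -
  obtain q where q: "\<And>z. z \<in> lens \<alpha> \<Longrightarrow> cmod (poly q z - lens_map z) < \<epsilon>"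
    using poly_approximable_lens_map \<epsilon> unfolding poly_approximable_def by blast
  define p where "p = q - [:poly q 0:]"
  have zero: "0 \<in> lens \<alpha>" using \<rho> by auto
  have "cmod (poly p z) \<le> 1 + 2 * \<epsilon>" if z: "z \<in> lens \<alpha>" for z
  proof -
    have "poly p z = lens_map z + (poly q z - lens_map z) - (poly q 0 - lens_map 0)"
      by (simp add: p_def lens_map_0)
    also have "cmod \<dots> \<le> cmod (lens_map z) + cmod (poly q z - lens_map z) + cmod (poly q 0 - lens_map 0)"
      by (meson add_right_mono norm_triangle_ineq norm_triangle_ineq4 order_trans)
    finally show ?thesis
      using norm_lens_map_le_1[OF z] q[OF z] q[OF zero] by linarith
  qed
  moreover have "cmod (poly (pderiv p) 0 - of_real (r * (pi / (2 * \<alpha>)))) \<le> \<epsilon> / \<rho>"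
  proof -
    define h where "h z = poly q z - lens_map z" for z
    have hol: "h holomorphic_on cball 0 \<rho>"
      unfolding h_def using lens_map_holomorphic \<rho>(2) holomorphic_on_subset
      by (intro holomorphic_intros) blast
    have "cmod ((deriv ^^ 1) h 0) \<le> fact 1 * \<epsilon> / \<rho> ^ 1"
    proof (rule Cauchy_inequality)
      show "h holomorphic_on ball 0 \<rho>"
        using hol ball_subset_cball by (rule holomorphic_on_subset)
      show "continuous_on (cball 0 \<rho>) h"
        using hol by (rule holomorphic_on_imp_continuous_on)
      show "cmod (h z) \<le> \<epsilon>" if "cmod (0 - z) = \<rho>" for z
        using q[of z] \<rho>(2) that by (force simp: h_def)
    qed (rule \<rho>(1))
    moreover have "deriv h 0 = poly (pderiv q) 0 - of_real (r * (pi / (2 * \<alpha>)))"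
      unfolding h_def by (intro DERIV_imp_deriv DERIV_diff poly_DERIV lens_map_has_field_derivative_0)
    ultimately show ?thesis
      by (simp add: p_def pderiv_diff pderiv_pCons)
  qed
  moreover have "poly p 0 = 0" by (simp add: p_def)
  ultimately show ?thesis by blast
qed

end

lemma exists_lens_polynomial_sequence:
  assumes \<alpha>: "0 < \<alpha>" "\<alpha> \<le> pi / 2"
  obtains p :: "nat \<Rightarrow> complex poly" and \<epsilon> :: "nat \<Rightarrow> real"
  where "\<epsilon> \<longlonglongrightarrow> 0" and "\<And>n. poly (p n) 0 = 0"
    and "\<And>n z. z \<in> lens \<alpha> \<Longrightarrow> cmod (poly (p n) z) \<le> 1 + \<epsilon> n"
    and "(\<lambda>n. poly (pderiv (p n)) 0) \<longlonglongrightarrow> of_real (pi / (2 * \<alpha>))"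
proof -
  obtain \<rho> where \<rho>: "0 < \<rho>" "cball 0 \<rho> \<subseteq> lens \<alpha>"
    using cball_subset_lens[OF \<alpha>] .
  define \<delta> :: "nat \<Rightarrow> real" where "\<delta> n = inverse (real (Suc n))" for n
  define r :: "nat \<Rightarrow> real" where "r n = real n / real (Suc n)" for n
  define \<beta> where "\<beta> = pi / (2 * \<alpha>)"
  have "\<exists>p. poly p 0 = 0 \<and> (\<forall>z\<in>lens \<alpha>. cmod (poly p z) \<le> 1 + 2 * \<delta> n)
      \<and> cmod (poly (pderiv p) 0 - of_real (r n * \<beta>)) \<le> \<delta> n / \<rho>" for n
    unfolding \<beta>_def by (rule exists_lens_polynomial[OF \<alpha> _ _ _ \<rho>]) (simp_all add: \<delta>_def r_def)
  then obtain p where p: "\<And>n. poly (p n) 0 = 0"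
      "\<And>n z. z \<in> lens \<alpha> \<Longrightarrow> cmod (poly (p n) z) \<le> 1 + 2 * \<delta> n"
      "\<And>n. cmod (poly (pderiv (p n)) 0 - of_real (r n * \<beta>)) \<le> \<delta> n / \<rho>"
    by metis
  have \<delta>: "\<delta> \<longlonglongrightarrow> 0"
    unfolding \<delta>_def by (rule LIMSEQ_inverse_real_of_nat)
  have "(\<lambda>n. poly (pderiv (p n)) 0 - of_real (r n * \<beta>)) \<longlonglongrightarrow> 0"
  proof (rule Lim_null_comparison)
    show "(\<lambda>n. \<delta> n / \<rho>) \<longlonglongrightarrow> 0"
      using tendsto_divide[OF \<delta> tendsto_const[of \<rho>]] \<rho>(1) by simp
  qed (use p(3) in simp)
  moreover have "(\<lambda>n. complex_of_real (r n * \<beta>)) \<longlonglongrightarrow> of_real (1 * \<beta>)"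
    unfolding r_def by (intro tendsto_intros LIMSEQ_n_over_Suc_n)
  ultimately have "(\<lambda>n. poly (pderiv (p n)) 0) \<longlonglongrightarrow> of_real \<beta>"
    using tendsto_add[of "\<lambda>n. poly (pderiv (p n)) 0 - of_real (r n * \<beta>)" 0 sequentially "\<lambda>n. of_real (r n * \<beta>)" "of_real (1 * \<beta>)"]
    by simp
  moreover have "(\<lambda>n. 2 * \<delta> n) \<longlonglongrightarrow> 0"
    using tendsto_mult_left[OF \<delta>, of 2] by simp
  ultimately show ?thesis
    using p by (intro that[of "\<lambda>n. 2 * \<delta> n" p]) (simp_all add: \<beta>_def)
qed

section \<open>Hilbert spaces transported along an injection\<close>

definition vec_ip :: "complex ^ 'n \<Rightarrow> complex ^ 'n \<Rightarrow> complex" where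
  "vec_ip x y = (\<Sum>i\<in>UNIV. x $ i * cnj (y $ i))"

lemma vec_ip_self: "vec_ip x x = of_real ((norm x)\<^sup>2)"
  by (simp add: vec_ip_def norm_vec_complex_sqr complex_norm_square del: of_real_power)

text \<open>
  The structure of the Hilbert space \<open>complex ^ 'n\<close> carried along an injection \<open>\<phi>\<close>.
\<close>

definition transported_space :: "(complex ^ 'n \<Rightarrow> 'h) \<Rightarrow> 'h hilbert" where
  "transported_space \<phi> = \<lparr>carrier = range \<phi>, monoid.mult = (\<lambda>x y. x), one = \<phi> 0, zero = \<phi> 0,
     add = (\<lambda>x y. \<phi> (the_inv \<phi> x + the_inv \<phi> y)), smult = (\<lambda>c x. \<phi> (c *s the_inv \<phi> x)),
     ip = (\<lambda>x y. vec_ip (the_inv \<phi> x) (the_inv \<phi> y))\<rparr>"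

definition transported_operator :: "(complex ^ 'n \<Rightarrow> 'h) \<Rightarrow> complex ^ 'n ^ 'n \<Rightarrow> 'h \<Rightarrow> 'h" where
  "transported_operator \<phi> M x = \<phi> (M *v the_inv \<phi> x)"

lemma cring_complex_ring: "cring complex_ring"
proof (rule cringI)
  show "abelian_group complex_ring"
  proof (rule abelian_groupI)
    show "\<exists>y\<in>carrier complex_ring. y \<oplus>\<^bsub>complex_ring\<^esub> x = \<zero>\<^bsub>complex_ring\<^esub>" for x
      by (rule bexI[of _ "- x"]) (simp_all add: complex_ring_def)
  qed (simp_all add: complex_ring_def)
  show "Group.comm_monoid complex_ring"
    by (rule comm_monoidI) (simp_all add: complex_ring_def)
qed (simp add: complex_ring_def distrib_right)

lemma mat_vector_mult: "mat c *v w = c *s (w :: complex ^ 'n)"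
  by (simp add: vec_eq_iff matrix_vector_mult_def mat_def if_distrib[of "\<lambda>x. x * _"] cong: if_cong)

lemma sum_matrix_vector_mult: "(\<Sum>k\<in>S. F k) *v v = (\<Sum>k\<in>S. F k *v (v :: complex ^ 'n))"
  by (induction S rule: infinite_finite_induct) (simp_all add: matrix_vector_mult_add_rdistrib)

locale transported =
  fixes \<phi> :: "complex ^ 'n \<Rightarrow> 'h"
  assumes inj: "inj \<phi>"
begin

abbreviation "H \<equiv> transported_space \<phi>"
abbreviation "Op M \<equiv> transported_operator \<phi> M"

lemma inv_phi [simp]: "the_inv \<phi> (\<phi> v) = v"
  using inj by (rule the_inv_f_f)

lemma carrier_H [simp]: "carrier H = range \<phi>"
  by (simp add: transported_space_def)

lemma add_H [simp]: "\<phi> v \<oplus>\<^bsub>H\<^esub> \<phi> w = \<phi> (v + w)"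
  by (simp add: transported_space_def)

lemma zero_H [simp]: "\<zero>\<^bsub>H\<^esub> = \<phi> 0"
  by (simp add: transported_space_def)

lemma smult_H [simp]: "c \<odot>\<^bsub>H\<^esub> \<phi> v = \<phi> (c *s v)"
  by (simp add: transported_space_def)

lemma ip_H [simp]: "ip H (\<phi> v) (\<phi> w) = vec_ip v w"
  by (simp add: transported_space_def)

lemma hnorm_H [simp]: "hnorm H (\<phi> v) = norm v"
  by (simp add: hnorm_def vec_ip_self)

lemma Op_phi [simp]: "Op M (\<phi> v) = \<phi> (M *v v)"
  by (simp add: transported_operator_def)

lemma abelian_group_H: "abelian_group H"
proof (rule abelian_groupI)
  fix x assume "x \<in> carrier H"
  then obtain v where "x = \<phi> v" by auto
  then show "\<exists>y\<in>carrier H. y \<oplus>\<^bsub>H\<^esub> x = \<zero>\<^bsub>H\<^esub>"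
    by (intro bexI[of _ "\<phi> (- v)"]) auto
qed (auto simp: add_ac)

text \<open>
  The equation holds outside the carrier too, whatever \<open>the_inv \<phi>\<close> returns there. This is needed
  because \<open>Metric_space\<close> asks for nonnegativity and symmetry of the distance at all points.
\<close>

lemma minus_H_eq: "x \<ominus>\<^bsub>H\<^esub> y = \<phi> (the_inv \<phi> x - the_inv \<phi> y)"
proof -
  have "\<ominus>\<^bsub>H\<^esub> y = \<phi> (- the_inv \<phi> y)"
    unfolding a_inv_def m_inv_def
  proof (rule the_equality, goal_cases)
    case 1
    show ?case by (simp add: transported_space_def)
  next
    case (2 z)
    then obtain w where w: "z = \<phi> w" by auto
    with 2 have "\<phi> (the_inv \<phi> y + w) = \<phi> 0"
      by (simp add: transported_space_def)
    then have "the_inv \<phi> y + w = 0"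
      by (rule injD[OF inj])
    then show ?case by (simp add: w add_eq_0_iff)
  qed
  then show ?thesis
    by (simp add: a_minus_def transported_space_def)
qed

lemma minus_H [simp]: "\<phi> v \<ominus>\<^bsub>H\<^esub> \<phi> w = \<phi> (v - w)"
  by (simp add: minus_H_eq)

lemma module_H: "Module.module complex_ring H"
  by (rule moduleI[OF cring_complex_ring abelian_group_H])
     (auto simp: complex_ring_def vector_sadd_rdistrib vector_add_ldistrib vector_smult_assoc)

lemma mcomplete_H: "Metric_space.mcomplete (carrier H) (\<lambda>x y. hnorm H (x \<ominus>\<^bsub>H\<^esub> y))"
proof -
  interpret Metric_space "carrier H" "\<lambda>x y. hnorm H (x \<ominus>\<^bsub>H\<^esub> y)"
  proof
    fix x y z
    show "0 \<le> hnorm H (x \<ominus>\<^bsub>H\<^esub> y)"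
      by (simp add: minus_H_eq)
    show "hnorm H (x \<ominus>\<^bsub>H\<^esub> y) = hnorm H (y \<ominus>\<^bsub>H\<^esub> x)"
      by (simp add: minus_H_eq norm_minus_commute)
    assume "x \<in> carrier H" "y \<in> carrier H"
    then obtain u v where uv: "x = \<phi> u" "y = \<phi> v" by auto
    then show "hnorm H (x \<ominus>\<^bsub>H\<^esub> y) = 0 \<longleftrightarrow> x = y"
      using inj by (auto dest: injD)
    assume "z \<in> carrier H"
    then obtain w where "z = \<phi> w" by auto
    with uv show "hnorm H (x \<ominus>\<^bsub>H\<^esub> z) \<le> hnorm H (x \<ominus>\<^bsub>H\<^esub> y) + hnorm H (y \<ominus>\<^bsub>H\<^esub> z)"
      using norm_triangle_ineq[of "u - v" "v - w"] by simp
  qed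
  show ?thesis
    unfolding mcomplete_def
  proof (intro allI impI)
    fix \<sigma> assume C: "MCauchy \<sigma>"
    note C = C[unfolded MCauchy_def]
    define \<tau> where "\<tau> n = the_inv \<phi> (\<sigma> n)" for n
    have \<sigma>: "\<sigma> n = \<phi> (\<tau> n)" for n
    proof -
      have "\<sigma> n \<in> range \<phi>" using C by auto
      then show ?thesis by (simp add: \<tau>_def f_the_inv_into_f[OF inj])
    qed
    have "Cauchy \<tau>"
      using C by (simp add: Cauchy_def \<sigma> dist_norm)
    then obtain l where "\<tau> \<longlonglongrightarrow> l"
      using Cauchy_convergent convergent_def by blast
    then have "limitin mtopology \<sigma> (\<phi> l) sequentially"
      unfolding limit_metric_sequentially by (simp add: \<sigma> LIMSEQ_def dist_norm)
    then show "\<exists>x. limitin mtopology \<sigma> x sequentially" ..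
  qed
qed

lemma complex_hilbert_H: "complex_hilbert H"
proof (rule complex_hilbert.intro[OF module_H complex_hilbert_axioms.intro[OF _ _ _ _ _ mcomplete_H]])
  show "ip H (x \<oplus>\<^bsub>H\<^esub> y) z = ip H x z + ip H y z"
    if "x \<in> carrier H" "y \<in> carrier H" "z \<in> carrier H" for x y z
    using that by (auto simp: vec_ip_def algebra_simps sum.distrib)
  show "ip H (c \<odot>\<^bsub>H\<^esub> x) y = c * ip H x y" if "x \<in> carrier H" "y \<in> carrier H" for x y c
    using that by (auto simp: vec_ip_def algebra_simps sum_distrib_left)
  show "ip H y x = cnj (ip H x y)" if "x \<in> carrier H" "y \<in> carrier H" for x y
    using that by (auto simp: vec_ip_def mult.commute)
  show "0 \<le> Re (ip H x x)" if "x \<in> carrier H" for x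
    using that by (auto simp: vec_ip_self)
  show "x = \<zero>\<^bsub>H\<^esub>" if "x \<in> carrier H" "ip H x x = 0" for x
    using that by (auto simp: vec_ip_self)
qed

lemma bounded_operator_Op: "bounded_operator H (Op M)"
proof -
  have "norm (M *v v) \<le> onorm ((*v) M) * norm v" for v
    by (rule onorm[OF matrix_vector_mul_bounded_linear])
  then show ?thesis
    unfolding bounded_operator_def
    by (auto simp: matrix_vector_right_distrib vector_scalar_commute)
qed

lemma op_shift_Op:
  assumes "x \<in> carrier H"
  shows "op_shift H (Op M) c x = Op (M - mat c) x"
  using assms by (auto simp: op_shift_def matrix_vector_mult_diff_rdistrib mat_vector_mult)

lemma finsum_H: "finite S \<Longrightarrow> finsum H (\<lambda>k. \<phi> (f k)) S = \<phi> (\<Sum>k\<in>S. f k)"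
proof (induction S rule: finite_induct)
  interpret abelian_group H by (rule abelian_group_H)
  case empty show ?case by simp
next
  interpret abelian_group H by (rule abelian_group_H)
  case (insert a S)
  then show ?case by (subst finsum_insert) auto
qed

lemma op_poly_Op:
  assumes "x \<in> carrier H"
  shows "op_poly H p (Op M) x = Op (mat_poly p M) x"
proof -
  from assms obtain v where v: "x = \<phi> v" by auto
  have pow: "(Op M ^^ k) (\<phi> v) = \<phi> (((**) M ^^ k) (mat 1) *v v)" for k
    by (induction k) (simp_all add: matrix_vector_mul_assoc)
  have "op_poly H p (Op M) x = finsum H (\<lambda>k. \<phi> ((mat (coeff p k) ** ((**) M ^^ k) (mat 1)) *v v)) {..degree p}"
    by (simp add: op_poly_def v pow mat_vector_mult flip: matrix_vector_mul_assoc)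
  also have "\<dots> = \<phi> (mat_poly p M *v v)"
    by (simp add: finsum_H mat_poly_def sum_matrix_vector_mult)
  finally show ?thesis by (simp add: v)
qed

lemma op_norm_cong: "(\<And>x. x \<in> carrier H \<Longrightarrow> A x = B x) \<Longrightarrow> op_norm H A = op_norm H B"
  unfolding op_norm_def by (rule SUP_cong) auto

lemma op_norm_Op: "op_norm H (Op M) = mat_norm M"
proof (rule antisym)
  have bl: "bounded_linear ((*v) M)" by (rule matrix_vector_mul_bounded_linear)
  have le: "hnorm H (Op M x) \<le> mat_norm M" if "x \<in> {x \<in> carrier H. hnorm H x \<le> 1}" for x
  proof -
    from that obtain v where v: "x = \<phi> v" "norm v \<le> 1" by auto
    have "norm (M *v v) \<le> mat_norm M * norm v"
      unfolding mat_norm_def by (rule onorm[OF bl])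
    also have "\<dots> \<le> mat_norm M"
      using v(2) onorm_pos_le[OF bl] by (simp add: mat_norm_def mult_left_le)
    finally show ?thesis by (simp add: v)
  qed
  have "\<phi> 0 \<in> {x \<in> carrier H. hnorm H x \<le> 1}" by simp
  then show "op_norm H (Op M) \<le> mat_norm M"
    unfolding op_norm_def using le by (intro cSUP_least) blast+
  have bdd: "bdd_above ((\<lambda>x. hnorm H (Op M x)) ` {x \<in> carrier H. hnorm H x \<le> 1})"
    using le by (rule bdd_aboveI2)
  have unit: "norm (M *v u) \<le> op_norm H (Op M)" if "norm u \<le> 1" for u
    unfolding op_norm_def using cSUP_upper[OF _ bdd, of "\<phi> u"] that by simp
  show "mat_norm M \<le> op_norm H (Op M)"
    unfolding mat_norm_def
  proof (rule onorm_bound)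
    show "0 \<le> op_norm H (Op M)"
      using unit[of 0] by simp
    fix v
    show "norm (M *v v) \<le> op_norm H (Op M) * norm v"
    proof (cases "v = 0")
      case False
      have "norm (M *v (v /\<^sub>R norm v)) \<le> op_norm H (Op M)"
        using False by (intro unit) simp
      then show ?thesis
        using False by (simp add: linear_scale[OF bounded_linear.linear[OF bl]] field_simps)
    qed simp
  qed
qed

end

text \<open>
  Constant functions on \<open>'u\<close> already have room for \<open>complex ^ 2\<close>, because \<open>complex \<times> complex\<close> and
  \<open>complex\<close> are equinumerous. So the argument works for every \<open>'u\<close>, even a type with one element.
\<close>

lemma exists_inj_complex_vec:
  "\<exists>\<phi> :: complex ^ 2 \<Rightarrow> ('u \<Rightarrow> complex). inj \<phi>"
proof -
  have "(card_of (UNIV \<times> UNIV :: (complex \<times> complex) set), card_of (UNIV :: complex set)) \<in> ordIso"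
    by (rule card_of_Times_same_infinite) (rule infinite_UNIV_char_0)
  then obtain j :: "complex \<times> complex \<Rightarrow> complex" where "bij_betw j (UNIV \<times> UNIV) UNIV"
    using card_of_ordIso by blast
  then have j: "inj j"
    by (simp add: bij_betw_def)
  have "inj (\<lambda>v :: complex ^ 2. \<lambda>_ :: 'u. j (v $ 1, v $ 2))"
  proof (rule injI)
    fix v w :: "complex ^ 2"
    assume "(\<lambda>_ :: 'u. j (v $ 1, v $ 2)) = (\<lambda>_. j (w $ 1, w $ 2))"
    then have "j (v $ 1, v $ 2) = j (w $ 1, w $ 2)"
      by (rule fun_cong)
    then have "(v $ 1, v $ 2) = (w $ 1, w $ 2)"
      by (rule injD[OF j])
    then show "v = w"
      by (simp add: vec_eq_iff forall_2)
  qed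
  then show ?thesis
    by (rule exI[where P = inj])
qed

section \<open>The lower bound for the lens constant\<close>

lemma mat_norm_A_mat_shift:
  assumes s: "0 < sin \<alpha>"
  shows "mat_norm (A_mat \<alpha> - mat (\<i> * of_real (cot \<alpha>))) = 1 / sin \<alpha>"
    and "mat_norm (A_mat \<alpha> + mat (\<i> * of_real (cot \<alpha>))) = 1 / sin \<alpha>"
proof -
  have "mat_norm (toeplitz2 a (of_real (sin \<alpha>))) = 1 / sin \<alpha>" if "cmod a = \<bar>cot \<alpha>\<bar>" for a
    using s that by (intro mat_norm_toeplitz2_eq) (simp_all add: inverse_sin_square)
  then show "mat_norm (A_mat \<alpha> - mat (\<i> * of_real (cot \<alpha>))) = 1 / sin \<alpha>"
    and "mat_norm (A_mat \<alpha> + mat (\<i> * of_real (cot \<alpha>))) = 1 / sin \<alpha>"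
    by (simp_all add: A_mat_eq_toeplitz2 mat_eq_toeplitz2 toeplitz2_diff toeplitz2_add norm_mult)
qed

lemma spectral_set_disks_A_mat:
  assumes s: "0 < sin \<alpha>"
  shows "spectral_set (disk_plus \<alpha>) (A_mat \<alpha>)" and "spectral_set (disk_minus \<alpha>) (A_mat \<alpha>)"
proof -
  have "(sin \<alpha>)\<^sup>2 + (sin \<alpha> * cot \<alpha>)\<^sup>2 = 1" "(sin \<alpha>)\<^sup>2 + (sin \<alpha> * - cot \<alpha>)\<^sup>2 = 1"
    using s by (simp_all add: cot_def)
  then show "spectral_set (disk_plus \<alpha>) (A_mat \<alpha>)" and "spectral_set (disk_minus \<alpha>) (A_mat \<alpha>)"
    unfolding disk_plus_eq_cball disk_minus_eq_cball A_mat_eq_toeplitz2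
    using spectral_set_disk[OF s] by blast+
qed

text \<open>
  \<open>A_mat \<alpha>\<close>, transported to a subset of \<open>'u \<Rightarrow> complex\<close>, is one of the operators over which the
  supremum is taken.
\<close>

lemma lens_const_ge_matrix_ratio:
  assumes s: "0 < sin \<alpha>" and p: "p \<noteq> 0"
  shows "ereal (mat_norm (mat_poly p (A_mat \<alpha>)) / max_mod (lens \<alpha>) (poly p)) \<le> lens_const TYPE('u) \<alpha>"
proof -
  obtain \<phi> :: "complex ^ 2 \<Rightarrow> ('u \<Rightarrow> complex)" where "inj \<phi>"
    using exists_inj_complex_vec by blast
  then interpret transported \<phi> by unfold_locales
  let ?A = "A_mat \<alpha>"
  have shift: "op_norm H (op_shift H (Op ?A) c) = mat_norm (?A - mat c)" for c
    using op_norm_cong[OF op_shift_Op] by (simp only: op_norm_Op)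
  have "?A - mat (- \<i> * of_real (cot \<alpha>)) = ?A + mat (\<i> * of_real (cot \<alpha>))"
    by (simp add: mat_eq_toeplitz2 A_mat_eq_toeplitz2 toeplitz2_add toeplitz2_diff)
  then have "admissible \<alpha> H (Op ?A)"
    unfolding admissible_def shift
    by (simp only: mat_norm_A_mat_shift[OF s] complex_hilbert_H bounded_operator_Op order_refl simp_thms)
  moreover have "op_norm H (op_poly H p (Op ?A)) = mat_norm (mat_poly p ?A)"
    using op_norm_cong[OF op_poly_Op] by (simp only: op_norm_Op)
  ultimately show ?thesis
    unfolding lens_const_def using p
    by (intro SUP_upper2[where i = "(H, Op ?A)"]) (auto intro!: SUP_upper2[where i = p])
qed

lemma max_mod_lens_pos:
  assumes "0 < \<alpha>" and "\<alpha> \<le> pi / 2" and p: "p \<noteq> 0"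
  shows "0 < max_mod (lens \<alpha>) (poly p)"
proof -
  obtain \<rho> where "0 < \<rho>" and sub: "cball 0 \<rho> \<subseteq> lens \<alpha>"
    using cball_subset_lens[OF assms(1,2)] .
  then have "infinite (cball (0 :: complex) \<rho>)"
    using uncountable_cball countable_finite by blast
  then have "\<not> cball 0 \<rho> \<subseteq> {z. poly p z = 0}"
    using poly_roots_finite[OF p] finite_subset by blast
  then obtain z where "z \<in> lens \<alpha>" "poly p z \<noteq> 0"
    using sub by blast
  then show ?thesis
    using max_mod_upper[OF compact_lens _ \<open>z \<in> lens \<alpha>\<close>, of "poly p"]
    by (simp add: continuous_on_poly less_le_trans[of 0 "cmod (poly p z)"])
qed

theorem corollary1p3:
  fixes \<alpha> :: real
  assumes "0 < \<alpha>" and "\<alpha> \<le> pi / 2"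
  shows "mat_norm (A_mat \<alpha> - mat (\<i> * of_real (cot \<alpha>))) = 1 / sin \<alpha>
    \<and> mat_norm (A_mat \<alpha> + mat (\<i> * of_real (cot \<alpha>))) = 1 / sin \<alpha>
    \<and> spectral_set (disk_plus \<alpha>) (A_mat \<alpha>)
    \<and> spectral_set (disk_minus \<alpha>) (A_mat \<alpha>)
    \<and> lens_const TYPE('u) \<alpha> \<ge> ereal (pi * sin \<alpha> / (2 * \<alpha>))
    \<and> (\<exists>(p :: nat \<Rightarrow> complex poly) \<epsilon> :: nat \<Rightarrow> real.
          \<epsilon> \<longlonglongrightarrow> 0
          \<and> (\<forall>n. max_mod (lens \<alpha>) (poly (p n)) \<le> 1 + \<epsilon> n)
          \<and> (\<lambda>n. mat_norm (mat_poly (p n) (A_mat \<alpha>))) \<longlonglongrightarrow> pi * sin \<alpha> / (2 * \<alpha>))"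
proof -
  note s = sin_pos_cot_nonneg(1)[OF assms]
  define L where "L = pi * sin \<alpha> / (2 * \<alpha>)"
  have L: "0 < L"
    using assms s by (simp add: L_def)
  obtain p \<epsilon> where \<epsilon>: "\<epsilon> \<longlonglongrightarrow> (0 :: real)" and p0: "\<And>n. poly (p n) 0 = 0"
    and p_le: "\<And>n z. z \<in> lens \<alpha> \<Longrightarrow> cmod (poly (p n) z) \<le> 1 + \<epsilon> n"
    and dp: "(\<lambda>n. poly (pderiv (p n)) 0) \<longlonglongrightarrow> of_real (pi / (2 * \<alpha>))"
    by (rule exists_lens_polynomial_sequence[OF assms]) (rule that)
  define N where "N n = mat_norm (mat_poly (p n) (A_mat \<alpha>))" for n
  define m where "m n = max_mod (lens \<alpha>) (poly (p n))" for n
  have "0 \<in> lens \<alpha>"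
    using mem_lens_iff[OF assms] by simp
  then have m_le: "m n \<le> 1 + \<epsilon> n" for n
    unfolding m_def max_mod_def using p_le by (intro cSUP_least) auto
  have N_eq: "N n = cmod (of_real (sin \<alpha>) * poly (pderiv (p n)) 0)" for n
    by (simp add: N_def A_mat_eq_toeplitz2 mat_poly_nilpotent_toeplitz2 p0 mat_norm_toeplitz2_0)
  have "N \<longlonglongrightarrow> cmod (of_real (sin \<alpha>) * of_real (pi / (2 * \<alpha>)))"
    unfolding N_eq by (intro tendsto_intros dp)
  moreover have "cmod (of_real (sin \<alpha>) * of_real (pi / (2 * \<alpha>))) = L"
    using s assms unfolding of_real_mult[symmetric] norm_of_real by (simp add: L_def mult.commute)
  ultimately have N: "N \<longlonglongrightarrow> L"
    by simp
  have "ereal L \<le> lens_const TYPE('u) \<alpha>"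
  proof (rule tendsto_upperbound)
    have "(\<lambda>n. N n / (1 + \<epsilon> n)) \<longlonglongrightarrow> L / (1 + 0)"
      by (intro tendsto_intros N \<epsilon>) simp
    then show "(\<lambda>n. ereal (N n / (1 + \<epsilon> n))) \<longlonglongrightarrow> ereal L"
      by simp
    \<comment> \<open>The first members of the sequence may be the zero polynomial, over which the supremum
      does not range.\<close>
    have "\<forall>\<^sub>F n in sequentially. 0 < N n"
      using N L by (rule order_tendstoD)
    then show "\<forall>\<^sub>F n in sequentially. ereal (N n / (1 + \<epsilon> n)) \<le> lens_const TYPE('u) \<alpha>"
    proof eventually_elim
      case (elim n)
      have "p n \<noteq> 0"
        using elim N_eq[of n] by auto
      then have "0 < m n" and le: "ereal (N n / m n) \<le> lens_const TYPE('u) \<alpha>"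
        unfolding m_def N_def by (rule max_mod_lens_pos[OF assms], rule lens_const_ge_matrix_ratio[OF s])
      have "N n / (1 + \<epsilon> n) \<le> N n / m n"
        using \<open>0 < m n\<close> m_le[of n] elim by (intro divide_left_mono mult_pos_pos) auto
      then show ?case
        using le order_trans ereal_less_eq(3) by blast
    qed
  qed simp
  then show ?thesis
    using mat_norm_A_mat_shift[OF s] spectral_set_disks_A_mat[OF s] \<epsilon> m_le N
    unfolding m_def N_def L_def by (intro conjI exI[of _ p] exI[of _ \<epsilon>] allI)
qed

end
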